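(* The sets $\mathcal{B}(x)^{-1}=\{u^{-1}:u\in\mathcal{B}(x)\}$, for $x$ ranging over the involutions of $S_n$, are exactly the distinct equivalence classes of $S_n$ under $\sim_{\mathcal{B}}$ (permutations being identified with their one-line sequences $[w(1),\dots,w(n)]$).
   Context: $S_n$ is the Coxeter group with simple generators $s_i=(i,i+1)$ and length $\ell$. The Demazure product $\circ$ is the unique associative operation on $S_n$ with $s\circ w = sw$ if $\ell(sw)>\ell(w)$ and $s\circ w=w$ otherwise, and $w\circ s=ws$ if $\ell(ws)>\ell(w)$ and $w\circ s = w$ otherwise. For an involution $x$, $\mathcal{B}(x)=\{w\in S_n: w^{-1}\circ w = x\}$ (i.e. $w^{-1}\circ 1\circ w=x$). The relation $\sim_{\mathcal{B}}$ (the Chinese relation) is the smallest equivalence relation on integer sequences such that $[\cdots,c,a,b,\cdots]\sim_{\mathcal{B}}[\cdots,b,c,a,\cdots]\sim_{\mathcal{B}}[\cdots,c,b,a,\cdots]$ whenever $a\leq b\leq c$, where the displayed triples occupy the same consecutive positions and the sequences agree in all other positions. *)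

theory Defs
  imports "HOL-Combinatorics.Permutations"
begin

definition perms :: "nat \<Rightarrow> (nat \<Rightarrow> nat) set" where
  "perms n = {w. w permutes {1..n}}"

definition simple_gens :: "nat \<Rightarrow> (nat \<Rightarrow> nat) set" where
  "simple_gens n = {transpose i (Suc i) | i. 1 \<le> i \<and> i < n}"

definition cox_length :: "nat \<Rightarrow> (nat \<Rightarrow> nat) \<Rightarrow> nat" where
  "cox_length n w =
     (LEAST k. \<exists>ss. set ss \<subseteq> simple_gens n \<and> length ss = k \<and> foldr (\<circ>) ss id = w)"

(* The unit law is stated explicitly because the other conditions do not imply it for n = 2:
   there the constant operation with value transpose 1 2 satisfies all of them. The last
   condition fixes the values of the total function D outside the symmetric group, so that D
   is unique as an object of the logic. *)
definition is_demazure_product ::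
    "nat \<Rightarrow> ((nat \<Rightarrow> nat) \<Rightarrow> (nat \<Rightarrow> nat) \<Rightarrow> (nat \<Rightarrow> nat)) \<Rightarrow> bool" where
  "is_demazure_product n D \<longleftrightarrow>
     (\<forall>u\<in>perms n. \<forall>v\<in>perms n. D u v \<in> perms n) \<and>
     (\<forall>u\<in>perms n. \<forall>v\<in>perms n. \<forall>w\<in>perms n. D (D u v) w = D u (D v w)) \<and>
     (\<forall>w\<in>perms n. D id w = w \<and> D w id = w) \<and>
     (\<forall>s\<in>simple_gens n. \<forall>w\<in>perms n.
        D s w = (if cox_length n (s \<circ> w) > cox_length n w then s \<circ> w else w) \<and>
        D w s = (if cox_length n (w \<circ> s) > cox_length n w then w \<circ> s else w)) \<and>
     (\<forall>u v. \<not> (u \<in> perms n \<and> v \<in> perms n) \<longrightarrow> D u v = undefined)"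

definition demazure :: "nat \<Rightarrow> (nat \<Rightarrow> nat) \<Rightarrow> (nat \<Rightarrow> nat) \<Rightarrow> (nat \<Rightarrow> nat)" where
  "demazure n = (THE D. is_demazure_product n D)"

(* The identity counts as an involution. *)
definition involutions :: "nat \<Rightarrow> (nat \<Rightarrow> nat) set" where
  "involutions n = {x \<in> perms n. x \<circ> x = id}"

definition hecke_atoms_set :: "nat \<Rightarrow> (nat \<Rightarrow> nat) \<Rightarrow> (nat \<Rightarrow> nat) set" where
  "hecke_atoms_set n x = {w \<in> perms n. demazure n (inv w) w = x}"

inductive chinese_step :: "int list \<Rightarrow> int list \<Rightarrow> bool" where
  cab_bca: "a \<le> b \<Longrightarrow> b \<le> c \<Longrightarrow> chinese_step (xs @ [c, a, b] @ ys) (xs @ [b, c, a] @ ys)"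
| bca_cba: "a \<le> b \<Longrightarrow> b \<le> c \<Longrightarrow> chinese_step (xs @ [b, c, a] @ ys) (xs @ [c, b, a] @ ys)"

definition chinese_equiv :: "int list \<Rightarrow> int list \<Rightarrow> bool" where
  "chinese_equiv = equivclp chinese_step"

definition one_line :: "nat \<Rightarrow> (nat \<Rightarrow> nat) \<Rightarrow> int list" where
  "one_line n w = map (\<lambda>i. int (w i)) [1..<Suc n]"

definition chinese_rel :: "nat \<Rightarrow> ((nat \<Rightarrow> nat) \<times> (nat \<Rightarrow> nat)) set" where
  "chinese_rel n = {(u, v). u \<in> perms n \<and> v \<in> perms n \<and>
                            chinese_equiv (one_line n u) (one_line n v)}"

end

theory Submission
  imports Defs
begin

text \<open>
  The set of inverses of the elements of \<open>hecke_atoms_set n x\<close> is the fibre over \<open>x\<close> of the map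
  \<open>g u = u \<circ> u\<^sup>-\<^sup>1\<close> (a Demazure product; \<open>dsq\<close> below). Three neighbouring letters in the
  orders \<open>cab\<close>, \<open>bca\<close>, \<open>cba\<close> correspond to factorisations \<open>p \<circ> t \<circ> s\<close>, \<open>p \<circ> s \<circ> t\<close>, \<open>p \<circ> s \<circ> t \<circ> s\<close> with
  adjacent generators \<open>s\<close>, \<open>t\<close>, and the braid relation makes \<open>g\<close> equal on them; so \<open>g\<close> is constant
  on Chinese classes. It hits every involution, by induction along descents. Conversely, an
  insertion procedure moves each permutation to a canonical word of blocks \<open>b a\<close> (\<open>a < b\<close>) or
  \<open>b\<close> with increasing first letters, and these words are parametrised by involutions; comparing
  cardinalities, \<open>g\<close> separates the classes.
\<close>

section \<open>Length and inversions\<close>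

abbreviation sgen :: "nat \<Rightarrow> nat \<Rightarrow> nat" where
  "sgen i \<equiv> transpose i (Suc i)"

definition inversions :: "nat \<Rightarrow> (nat \<Rightarrow> nat) \<Rightarrow> (nat \<times> nat) set" where
  "inversions n w = {(i, j). 1 \<le> i \<and> i < j \<and> j \<le> n \<and> w j < w i}"

lemma finite_inversions: "finite (inversions n w)"
  by (rule finite_subset[of _ "{1..n} \<times> {1..n}"]) (auto simp: inversions_def)

lemma id_perms: "id \<in> perms n"
  by (simp add: perms_def permutes_id)

lemma comp_perms: "u \<in> perms n \<Longrightarrow> v \<in> perms n \<Longrightarrow> u \<circ> v \<in> perms n"
  by (simp add: perms_def permutes_compose)

lemma inv_perms: "u \<in> perms n \<Longrightarrow> inv u \<in> perms n"
  by (simp add: perms_def permutes_inv)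

lemma inv_inv_perms: "u \<in> perms n \<Longrightarrow> inv (inv u) = u"
  by (simp add: perms_def permutes_inv_inv)

lemma bij_perms: "u \<in> perms n \<Longrightarrow> bij u"
  by (auto simp: perms_def permutes_bij)

lemma sgen_perms: "1 \<le> i \<Longrightarrow> i < n \<Longrightarrow> sgen i \<in> perms n"
  by (auto simp: perms_def intro!: permutes_swap_id)

lemma inv_sgen_comp: "bij w \<Longrightarrow> inv (sgen i \<circ> w) = inv w \<circ> sgen i"
  by (simp add: o_inv_distrib)

lemma inv_comp_sgen: "bij w \<Longrightarrow> inv (w \<circ> sgen i) = sgen i \<circ> inv w"
  by (simp add: o_inv_distrib)

lemma sgen_sgen_comp: "sgen i \<circ> (sgen i \<circ> w) = w"
  by (simp add: fun_eq_iff)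

lemma comp_sgen_sgen: "(w \<circ> sgen i) \<circ> sgen i = w"
  by (simp add: fun_eq_iff)

text \<open>Applying \<open>sgen i\<close> to both entries of each pair matches the inversions of
  \<open>w\<close> with those of \<open>w \<circ> sgen i\<close> other than
  \<open>(i, Suc i)\<close>, because exchanging \<open>i\<close> and \<open>Suc i\<close> puts no
  other pair of positions out of order.\<close>

lemma card_inversions_ascent:
  assumes "1 \<le> i" "i < n" "w i < w (Suc i)"
  shows "card (inversions n (w \<circ> sgen i)) = Suc (card (inversions n w))"
proof -
  let ?f = "map_prod (sgen i) (sgen i)"
  have "inversions n (w \<circ> sgen i) = insert (i, Suc i) (?f ` inversions n w)"
  proof (rule set_eqI, clarify)
    fix a b
    have "(a, b) \<in> ?f ` inversions n w \<longleftrightarrow> (sgen i a, sgen i b) \<in> inversions n w"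
      by (force simp: image_iff map_prod_def split: prod.splits)
    then show "(a, b) \<in> inversions n (w \<circ> sgen i)
        \<longleftrightarrow> (a, b) \<in> insert (i, Suc i) (?f ` inversions n w)"
      using assms by (auto simp: inversions_def transpose_def)
  qed
  moreover have "(i, Suc i) \<notin> ?f ` inversions n w"
    using assms by (auto simp: inversions_def transpose_def split: if_splits)
  moreover have "inj_on ?f (inversions n w)"
    by (rule inj_on_subset[of _ UNIV]) (auto intro!: prod.inj_map)
  ultimately show ?thesis
    by (simp add: finite_inversions card_image)
qed

lemma card_inversions_descent:
  assumes "1 \<le> i" "i < n" "w (Suc i) < w i"
  shows "Suc (card (inversions n (w \<circ> sgen i))) = card (inversions n w)"
  using card_inversions_ascent[of i n "w \<circ> sgen i"] assms comp_sgen_sgen[of w i] by simp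

text \<open>Exchanging the roles of positions and values turns an inversion of \<open>w\<close> into
  one of \<open>inv w\<close>.\<close>

lemma card_inversions_inv:
  assumes "w \<in> perms n"
  shows "card (inversions n (inv w)) = card (inversions n w)"
proof -
  have *: "bij_betw (\<lambda>(i, j). (w j, w i)) (inversions n w) (inversions n (inv w))"
    if "w \<in> perms n" for w
  proof (rule bij_betw_byWitness[where f' = "\<lambda>(a, b). (inv w b, inv w a)"])
    have p: "w permutes {1..n}" using that by (simp add: perms_def)
    note perm_inv = permutes_inverses[OF p]
    have in1: "1 \<le> w i \<and> w i \<le> n" if "1 \<le> i" "i \<le> n" for i
      using permutes_in_image[OF p, of i] that by simp
    have in2: "1 \<le> inv w i \<and> inv w i \<le> n" if "1 \<le> i" "i \<le> n" for i
      using permutes_in_image[OF permutes_inv[OF p], of i] that by simp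
    show "\<forall>a\<in>inversions n w. (\<lambda>(a, b). (inv w b, inv w a)) ((\<lambda>(i, j). (w j, w i)) a) = a"
      "\<forall>a\<in>inversions n (inv w). (\<lambda>(i, j). (w j, w i)) ((\<lambda>(a, b). (inv w b, inv w a)) a) = a"
      by (auto simp: perm_inv)
    show "(\<lambda>(i, j). (w j, w i)) ` inversions n w \<subseteq> inversions n (inv w)"
      using in1 by (auto simp: inversions_def perm_inv)
    show "(\<lambda>(a, b). (inv w b, inv w a)) ` inversions n (inv w) \<subseteq> inversions n w"
      using in2 by (auto simp: inversions_def perm_inv)
  qed
  show ?thesis using bij_betw_same_card[OF *[OF assms]] by simp
qed

lemma perms_inj: "w \<in> perms n \<Longrightarrow> w i = w j \<longleftrightarrow> i = j"
  using bij_perms bij_is_inj inj_eq by metis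

text \<open>Ascents everywhere would force \<open>i \<le> w i\<close> throughout, and only the
  identity satisfies this.\<close>

lemma perms_exists_descent:
  assumes w: "w \<in> perms n" and "w \<noteq> id"
  obtains i where "1 \<le> i" "i < n" "w (Suc i) < w i"
proof -
  have p: "w permutes {1..n}" using w by (simp add: perms_def)
  have "\<exists>i. 1 \<le> i \<and> i < n \<and> w (Suc i) < w i"
  proof (rule ccontr)
    assume "\<not> ?thesis"
    then have asc: "w i < w (Suc i)" if "1 \<le> i" "i < n" for i
      using that perms_inj[OF w, of i "Suc i"] by (metis n_not_Suc_n nat_neq_iff)
    have "i \<le> w i" if "1 \<le> i" "i \<le> n" for i
      using that
    proof (induction i)
      case (Suc i)
      show ?case
      proof (cases "i = 0")
        case True
        then show ?thesis using permutes_in_image[OF p, of 1] Suc.prems by auto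
      next
        case False
        then show ?thesis using Suc asc[of i] by simp
      qed
    qed simp
    then have "w = id"
      using permutes_natset_ge[OF p] by auto
    then show False using \<open>w \<noteq> id\<close> by simp
  qed
  then show ?thesis using that by blast
qed

text \<open>The premise on \<open>inv w\<close> says that left multiplication by
  \<open>sgen i\<close> adds an inversion, so the induction builds a permutation along a reduced
  word.\<close>

lemma perms_induct [consumes 1, case_names id sgen]:
  assumes "w \<in> perms n"
    and "P id"
    and step: "\<And>i w. 1 \<le> i \<Longrightarrow> i < n \<Longrightarrow> w \<in> perms n \<Longrightarrow> inv w i < inv w (Suc i)
      \<Longrightarrow> P w \<Longrightarrow> P (sgen i \<circ> w)"
  shows "P w"
  using assms(1)
proof (induction "card (inversions n w)" arbitrary: w rule: less_induct)
  case less
  show ?case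
  proof (cases "w = id")
    case False
    have ne: "inv w \<noteq> id"
      using False inv_inv_perms[OF less.prems] by (metis inv_id)
    obtain i where i: "1 \<le> i" "i < n" "inv w (Suc i) < inv w i"
      using perms_exists_descent[OF inv_perms[OF less.prems] ne] .
    let ?v = "sgen i \<circ> w"
    have v: "?v \<in> perms n" using comp_perms sgen_perms i less.prems by blast
    have iv: "inv ?v = inv w \<circ> sgen i" using inv_sgen_comp bij_perms less.prems by blast
    have "card (inversions n ?v) < card (inversions n w)"
      using card_inversions_descent[of i n "inv w"] i iv card_inversions_inv[OF v]
        card_inversions_inv[OF less.prems] by simp
    then have "P ?v" using less v by blast
    moreover have "inv ?v i < inv ?v (Suc i)" using i iv by simp
    ultimately have "P (sgen i \<circ> ?v)" using step i v by blast
    then show ?thesis by (simp add: sgen_sgen_comp)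
  qed (use assms in simp)
qed

lemma card_inversions_sgen_comp:
  assumes "w \<in> perms n" "1 \<le> i" "i < n"
  shows "card (inversions n (sgen i \<circ> w)) =
    (if inv w i < inv w (Suc i) then Suc (card (inversions n w)) else card (inversions n w) - 1)"
proof -
  have "sgen i \<circ> w \<in> perms n" using comp_perms sgen_perms assms by blast
  then have "card (inversions n (sgen i \<circ> w)) = card (inversions n (inv w \<circ> sgen i))"
    using card_inversions_inv inv_sgen_comp bij_perms assms by metis
  moreover have "inv w i \<noteq> inv w (Suc i)"
    using perms_inj[OF inv_perms] assms by (metis n_not_Suc_n)
  ultimately show ?thesis
    using card_inversions_ascent[of i n "inv w"] card_inversions_descent[of i n "inv w"]
      assms card_inversions_inv[OF assms(1)] by (auto simp: not_less)
qed

text \<open>\<open>perms_induct\<close> yields a word with one letter per inversion; no shorter word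
  exists, since a generator raises the number of inversions by at most one.\<close>

lemma cox_length_eq_card_inversions:
  assumes "w \<in> perms n"
  shows "cox_length n w = card (inversions n w)"
  unfolding cox_length_def
proof (rule Least_equality)
  show "\<exists>ss. set ss \<subseteq> simple_gens n \<and> length ss = card (inversions n w) \<and> foldr (\<circ>) ss id = w"
    using assms
  proof (induction rule: perms_induct)
    case id
    have "inversions n id = {}" by (auto simp: inversions_def)
    then have "set [] \<subseteq> simple_gens n" "length [] = card (inversions n id)" "foldr (\<circ>) [] id = id"
      by simp_all
    then show ?case by blast
  next
    case (sgen i w)
    then obtain ss where "set ss \<subseteq> simple_gens n" "length ss = card (inversions n w)"
      "foldr (\<circ>) ss id = w" by blast
    moreover have "sgen i \<in> simple_gens n" using sgen by (auto simp: simple_gens_def)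
    ultimately have "set (sgen i # ss) \<subseteq> simple_gens n"
      "length (sgen i # ss) = card (inversions n (sgen i \<circ> w))"
      "foldr (\<circ>) (sgen i # ss) id = sgen i \<circ> w"
      using card_inversions_sgen_comp[OF sgen(3,1,2)] sgen(4) by simp_all
    then show ?case by blast
  qed
next
  fix k
  assume "\<exists>ss. set ss \<subseteq> simple_gens n \<and> length ss = k \<and> foldr (\<circ>) ss id = w"
  then obtain ss where ss: "set ss \<subseteq> simple_gens n" "length ss = k" "foldr (\<circ>) ss id = w"
    by blast
  have "foldr (\<circ>) ss id \<in> perms n \<and> card (inversions n (foldr (\<circ>) ss id)) \<le> length ss"
    using ss(1)
  proof (induction ss)
    case Nil
    have "inversions n id = {}" by (auto simp: inversions_def)
    then have "id \<in> perms n" "card (inversions n id) = 0" by (simp_all add: id_perms)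
    then show ?case by (simp add: id_def)
  next
    case (Cons s ss)
    then obtain i where i: "s = sgen i" "1 \<le> i" "i < n" by (auto simp: simple_gens_def)
    define v where "v = foldr (\<circ>) ss id"
    have v: "v \<in> perms n" "card (inversions n v) \<le> length ss"
      unfolding v_def using Cons.IH Cons.prems set_subset_Cons by (metis subset_trans)+
    have e: "foldr (\<circ>) (s # ss) id = sgen i \<circ> v" by (simp add: i v_def)
    have "sgen i \<circ> v \<in> perms n" using v i comp_perms sgen_perms by blast
    moreover have "card (inversions n (sgen i \<circ> v)) \<le> length (s # ss)"
      using card_inversions_sgen_comp[OF v(1) i(2,3)] v(2) by (cases "inv v i < inv v (Suc i)") auto
    ultimately show ?case unfolding e by blast
  qed
  then show "card (inversions n w) \<le> k" using ss by simp
qed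

section \<open>The Demazure product\<close>

text \<open>Since \<open>inv w i\<close> is the position of the value \<open>i\<close>, the test
  asks whether \<open>sgen i\<close> lengthens \<open>w\<close> from the left;
  \<open>lop_cox_length\<close> makes the link. Stated without lengths, it can be followed directly
  through products.\<close>

definition lop :: "nat \<Rightarrow> (nat \<Rightarrow> nat) \<Rightarrow> nat \<Rightarrow> nat" where
  "lop i w = (if inv w i < inv w (Suc i) then sgen i \<circ> w else w)"

definition rop :: "nat \<Rightarrow> (nat \<Rightarrow> nat) \<Rightarrow> nat \<Rightarrow> nat" where
  "rop i w = (if w i < w (Suc i) then w \<circ> sgen i else w)"

lemma lop_perms: "1 \<le> i \<Longrightarrow> i < n \<Longrightarrow> w \<in> perms n \<Longrightarrow> lop i w \<in> perms n"
  by (auto simp: lop_def intro!: comp_perms sgen_perms)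

lemma rop_perms: "1 \<le> i \<Longrightarrow> i < n \<Longrightarrow> w \<in> perms n \<Longrightarrow> rop i w \<in> perms n"
  by (auto simp: rop_def intro!: comp_perms sgen_perms)

lemma inv_lop: "w \<in> perms n \<Longrightarrow> inv (lop i w) = rop i (inv w)"
  by (simp add: lop_def rop_def inv_sgen_comp bij_perms)

lemma sgen_less_iff:
  "{a, b} \<noteq> {i, Suc i} \<Longrightarrow> sgen i a < sgen i b \<longleftrightarrow> a < b"
  by (auto simp: transpose_def)

text \<open>If \<open>w\<close> carries the pair \<open>j\<close>, \<open>Suc j\<close> to
  \<open>i\<close>, \<open>Suc i\<close> in this order, then
  \<open>sgen i \<circ> w = w \<circ> sgen j\<close>, and whichever operator comes second does
  nothing; in the reverse order neither acts. For any other \<open>w\<close>, neither operator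
  affects the test of the other.\<close>

lemma lop_rop_commute:
  assumes "bij w"
  shows "lop i (rop j w) = rop j (lop i w)"
proof (cases "{w j, w (Suc j)} = {i, Suc i}")
  case True
  then consider "w j = i" "w (Suc j) = Suc i" | "w j = Suc i" "w (Suc j) = i"
    by (auto simp: doubleton_eq_iff)
  then show ?thesis
  proof cases
    case 1
    then have i: "inv w i = j" "inv w (Suc i) = Suc j"
      using assms by (metis bij_inv_eq_iff)+
    have "sgen i \<circ> w = w \<circ> sgen j"
      using 1 transpose_comp_eq[OF assms, of i "Suc i"] i by metis
    then show ?thesis
      using 1 i assms
      by (simp add: lop_def rop_def inv_comp_sgen del: comp_apply) simp
  next
    case 2
    then have i: "inv w i = Suc j" "inv w (Suc i) = j"
      using assms by (metis bij_inv_eq_iff)+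
    then show ?thesis using 2 by (simp add: lop_def rop_def)
  qed
next
  case False
  have False': "{inv w i, inv w (Suc i)} \<noteq> {j, Suc j}"
  proof
    assume "{inv w i, inv w (Suc i)} = {j, Suc j}"
    then have "w ` {inv w i, inv w (Suc i)} = w ` {j, Suc j}" by simp
    then show False using False assms by (simp add: bij_is_surj surj_f_inv_f)
  qed
  show ?thesis
    using sgen_less_iff[OF False] sgen_less_iff[OF False'] assms
    by (simp add: lop_def rop_def inv_comp_sgen inv_sgen_comp comp_assoc)
qed

section \<open>Composites of left operators\<close>

definition lword :: "nat list \<Rightarrow> (nat \<Rightarrow> nat) \<Rightarrow> nat \<Rightarrow> nat" where
  "lword is = foldr lop is"

definition is_index_list :: "nat \<Rightarrow> nat list \<Rightarrow> bool" where
  "is_index_list n is \<longleftrightarrow> set is \<subseteq> {1..<n}"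

lemma lword_perms: "is_index_list n is \<Longrightarrow> w \<in> perms n \<Longrightarrow> lword is w \<in> perms n"
  by (induction "is") (auto simp: lword_def is_index_list_def intro: lop_perms)

lemma perms_lword:
  assumes "w \<in> perms n"
  obtains "is" where "is_index_list n is" "lword is id = w"
proof -
  have "\<exists>is. is_index_list n is \<and> lword is id = w"
    using assms
  proof (induction rule: perms_induct)
    case id
    show ?case by (intro exI[of _ "[]"]) (simp add: is_index_list_def lword_def)
  next
    case (sgen i w)
    then obtain "is" where "is_index_list n is" "lword is id = w" by blast
    then have "is_index_list n (i # is)" "lword (i # is) id = sgen i \<circ> w"
      using sgen(1,2,4) by (simp_all add: is_index_list_def lword_def lop_def)
    then show ?case by blast
  qed
  then show ?thesis using that by blast
qed

lemma lword_rop_commute: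
  assumes "is_index_list n is" "w \<in> perms n"
  shows "lword is (rop j w) = rop j (lword is w)"
  using assms(1)
proof (induction "is")
  case (Cons i "is")
  then have "is_index_list n is" by (simp add: is_index_list_def)
  then show ?case
    using Cons lop_rop_commute[OF bij_perms[OF lword_perms[OF _ assms(2)]]]
    by (simp add: lword_def)
qed (simp add: lword_def)

text \<open>Right operators commute with left ones and reach every permutation from the identity, so a
  composite of left operators is determined by its value at the identity.\<close>

lemma lword_eqI:
  assumes "is_index_list n is" "is_index_list n js" "lword is id = lword js id" "v \<in> perms n"
  shows "lword is v = lword js v"
proof -
  \<comment> \<open>Passing to inverses turns the left multiplications of
    \<open>perms_induct\<close> into the right operators that commute with
    \<open>lword\<close>.\<close>
  have "lword is (inv u) = lword js (inv u)" if "u \<in> perms n" for u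
    using that
  proof (induction rule: perms_induct)
    case id
    show ?case using assms(3) inv_id by metis
  next
    case (sgen i w)
    have "inv (sgen i \<circ> w) = rop i (inv w)"
      using inv_lop[OF sgen(3), of i] sgen(4) by (simp add: lop_def)
    then show ?case
      using lword_rop_commute assms inv_perms sgen by metis
  qed
  then show ?thesis using inv_perms inv_inv_perms assms(4) by metis
qed

text \<open>By \<open>lword_eqI\<close> the chosen word does not matter. The value
  \<open>undefined\<close> off the group matches the last clause of
  \<open>is_demazure_product\<close>.\<close>

definition dem :: "nat \<Rightarrow> (nat \<Rightarrow> nat) \<Rightarrow> (nat \<Rightarrow> nat) \<Rightarrow> (nat \<Rightarrow> nat)" where
  "dem n u v = (if u \<in> perms n \<and> v \<in> perms n
     then lword (SOME is. is_index_list n is \<and> lword is id = u) v else undefined)"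

lemma dem_lword:
  assumes "is_index_list n is" "lword is id = u" "v \<in> perms n"
  shows "dem n u v = lword is v"
proof -
  have u: "u \<in> perms n" using lword_perms[OF assms(1) id_perms] assms(2) by simp
  let ?js = "SOME is. is_index_list n is \<and> lword is id = u"
  have "is_index_list n ?js \<and> lword ?js id = u"
    by (rule someI[of _ "is"]) (use assms in simp)
  then show ?thesis using lword_eqI[of n ?js "is" v] assms u by (simp add: dem_def)
qed

lemma dem_perms: "u \<in> perms n \<Longrightarrow> v \<in> perms n \<Longrightarrow> dem n u v \<in> perms n"
  by (metis dem_lword lword_perms perms_lword)

text \<open>Concatenated words for \<open>u\<close> and \<open>v\<close> form a word for their
  product, so both sides are its action on \<open>w\<close>.\<close>

lemma dem_assoc:
  assumes "u \<in> perms n" "v \<in> perms n" "w \<in> perms n"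
  shows "dem n (dem n u v) w = dem n u (dem n v w)"
proof -
  obtain "is" where i: "is_index_list n is" "lword is id = u" using perms_lword assms by blast
  obtain js where j: "is_index_list n js" "lword js id = v" using perms_lword assms by blast
  have app: "lword (is @ js) x = lword is (lword js x)" for x by (simp add: lword_def)
  have "dem n u v = lword (is @ js) id" using dem_lword[OF i assms(2)] j app by simp
  moreover have "is_index_list n (is @ js)" using i j by (simp add: is_index_list_def)
  ultimately have "dem n (dem n u v) w = lword (is @ js) w"
    using dem_lword assms by metis
  then show ?thesis
    using app dem_lword[OF j assms(3)] dem_lword[OF i dem_perms[OF assms(2,3)]] by simp
qed

lemma dem_id:
  assumes "w \<in> perms n"
  shows "dem n id w = w" "dem n w id = w"
proof -
  show "dem n id w = w"
    using dem_lword[of n "[]" id w] assms by (simp add: is_index_list_def lword_def)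
  show "dem n w id = w"
    using perms_lword[OF assms] dem_lword id_perms by metis
qed

lemma lop_id: "lop i id = sgen i" and rop_id: "rop i id = sgen i"
  by (simp_all add: lop_def rop_def)

lemma dem_sgen_left:
  assumes "1 \<le> i" "i < n" "w \<in> perms n"
  shows "dem n (sgen i) w = lop i w"
  using dem_lword[of n "[i]" "sgen i" w] assms lop_id
  by (simp add: is_index_list_def lword_def)

text \<open>As \<open>sgen i\<close> is \<open>rop i id\<close>, the right operator can be pulled
  out of the word that represents \<open>w\<close>.\<close>

lemma dem_sgen_right:
  assumes "1 \<le> i" "i < n" "w \<in> perms n"
  shows "dem n w (sgen i) = rop i w"
proof -
  obtain "is" where i: "is_index_list n is" "lword is id = w" using perms_lword assms by blast
  have "dem n w (sgen i) = lword is (rop i id)"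
    using dem_lword[OF i sgen_perms[OF assms(1,2)]] by (simp add: rop_id)
  then show ?thesis using lword_rop_commute[OF i(1) id_perms] i(2) by simp
qed

lemma simple_gensE:
  assumes "s \<in> simple_gens n"
  obtains i where "1 \<le> i" "i < n" "s = sgen i"
  using assms by (auto simp: simple_gens_def)

lemma lop_cox_length:
  assumes "1 \<le> i" "i < n" "w \<in> perms n"
  shows "(if cox_length n w < cox_length n (sgen i \<circ> w) then sgen i \<circ> w else w) = lop i w"
proof -
  have "card (inversions n (sgen i \<circ> w)) \<le> card (inversions n w)" if "\<not> inv w i < inv w (Suc i)"
    using card_inversions_sgen_comp[OF assms(3,1,2)] that by simp
  moreover have "card (inversions n w) < card (inversions n (sgen i \<circ> w))" if "inv w i < inv w (Suc i)"
    using card_inversions_sgen_comp[OF assms(3,1,2)] that by simp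
  ultimately show ?thesis
    using assms comp_perms[OF sgen_perms[OF assms(1,2)] assms(3)]
    by (auto simp: lop_def cox_length_eq_card_inversions)
qed

lemma rop_cox_length:
  assumes "1 \<le> i" "i < n" "w \<in> perms n"
  shows "(if cox_length n w < cox_length n (w \<circ> sgen i) then w \<circ> sgen i else w) = rop i w"
proof -
  have "w i \<noteq> w (Suc i)" using perms_inj[OF assms(3)] by simp
  then show ?thesis
    using assms comp_perms[OF assms(3) sgen_perms[OF assms(1,2)]]
      card_inversions_ascent[of i n w] card_inversions_descent[of i n w]
    by (auto simp: rop_def cox_length_eq_card_inversions)
qed

lemma is_demazure_product_dem: "is_demazure_product n (dem n)"
  unfolding is_demazure_product_def
proof (intro conjI ballI)
  fix s w
  assume "s \<in> simple_gens n" "w \<in> perms n"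
  then show "dem n s w = (if cox_length n w < cox_length n (s \<circ> w) then s \<circ> w else w)"
    "dem n w s = (if cox_length n w < cox_length n (w \<circ> s) then w \<circ> s else w)"
    by (metis simple_gensE dem_sgen_left lop_cox_length)
      (metis \<open>s \<in> simple_gens n\<close> \<open>w \<in> perms n\<close> simple_gensE dem_sgen_right rop_cox_length)
next
  show "\<forall>u v. \<not> (u \<in> perms n \<and> v \<in> perms n) \<longrightarrow> dem n u v = undefined"
    by (auto simp: dem_def)
qed (simp_all add: dem_perms dem_assoc dem_id)

text \<open>For uniqueness, associativity strips generators off the left factor until the unit law
  applies; outside the group both functions are \<open>undefined\<close>.\<close>

lemma demazure_eq_dem: "demazure n = dem n"
  unfolding demazure_def
proof (rule the_equality, rule is_demazure_product_dem)
  fix D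
  assume D: "is_demazure_product n D"
  have "D u v = dem n u v" if "u \<in> perms n" "v \<in> perms n" for u v
    using that
  proof (induction rule: perms_induct)
    case id
    then have "D id v = v" using D by (simp add: is_demazure_product_def)
    then show ?case using dem_id(1)[OF id] by metis
  next
    case (sgen i w)
    have s: "sgen i \<in> simple_gens n" "sgen i \<in> perms n"
      using sgen by (auto simp: simple_gens_def intro: sgen_perms)
    have l: "D (sgen i) x = dem n (sgen i) x" if "x \<in> perms n" for x
      using D s that sgen lop_cox_length[of i n x] dem_sgen_left[of i n x]
      by (simp add: is_demazure_product_def)
    have e: "sgen i \<circ> w = dem n (sgen i) w"
      using sgen by (simp add: dem_sgen_left lop_def)
    have "D (sgen i \<circ> w) v = D (sgen i) (D w v)"
      using D s sgen l e unfolding is_demazure_product_def by metis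
    also have "\<dots> = dem n (sgen i \<circ> w) v"
      using e l sgen dem_perms dem_assoc s by simp
    finally show ?case .
  qed
  moreover have "D u v = dem n u v" if "\<not> (u \<in> perms n \<and> v \<in> perms n)" for u v
    using D that by (auto simp: is_demazure_product_def dem_def)
  ultimately show "D = dem n" by blast
qed

text \<open>Inversion exchanges \<open>lop i\<close> with \<open>rop i\<close>; induction on the
  left factor extends this from generators to all products.\<close>

lemma inv_dem:
  assumes "u \<in> perms n" "v \<in> perms n"
  shows "inv (dem n u v) = dem n (inv v) (inv u)"
  using assms
proof (induction rule: perms_induct)
  case id
  then show ?case using dem_id inv_perms inv_id by metis
next
  case (sgen i w)
  note s = sgen_perms[OF sgen(1,2)]
  have e: "sgen i \<circ> w = dem n (sgen i) w"
    using sgen by (simp add: dem_sgen_left lop_def)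
  have l: "inv (dem n (sgen i) x) = dem n (inv x) (sgen i)" if "x \<in> perms n" for x
    using that sgen by (simp add: dem_sgen_left dem_sgen_right inv_perms inv_lop)
  show ?case
    unfolding e using sgen s by (simp add: l dem_assoc dem_perms inv_perms)
qed

section \<open>The symmetric Demazure square\<close>

definition dsq :: "nat \<Rightarrow> (nat \<Rightarrow> nat) \<Rightarrow> nat \<Rightarrow> nat" where
  "dsq n u = dem n u (inv u)"

lemma inv_involution: "x \<in> involutions n \<Longrightarrow> inv x = x"
  by (auto simp: involutions_def intro: inv_unique_comp)

lemma dsq_involution:
  assumes "u \<in> perms n"
  shows "dsq n u \<in> involutions n"
proof -
  have p: "dsq n u \<in> perms n" using assms by (simp add: dsq_def dem_perms inv_perms)
  have "inv (dsq n u) = dsq n u"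
    using assms by (simp add: dsq_def inv_dem inv_perms inv_inv_perms)
  then have "dsq n u \<circ> dsq n u = id"
    using bij_perms[OF p] by (metis bij_is_inj inv_o_cancel)
  then show ?thesis using p by (simp add: involutions_def)
qed

lemma dsq_dem:
  assumes "u \<in> perms n" "v \<in> perms n"
  shows "dsq n (dem n u v) = dem n u (dem n (dsq n v) (inv u))"
  using assms by (simp add: dsq_def inv_dem dem_assoc dem_perms inv_perms)

lemma inv_image_hecke_atoms: "inv ` hecke_atoms_set n x = {u \<in> perms n. dsq n u = x}"
proof (intro equalityI subsetI)
  fix u assume "u \<in> inv ` hecke_atoms_set n x"
  then show "u \<in> {u \<in> perms n. dsq n u = x}"
    by (auto simp: hecke_atoms_set_def demazure_eq_dem dsq_def inv_perms inv_inv_perms)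
next
  fix u assume "u \<in> {u \<in> perms n. dsq n u = x}"
  then have "inv u \<in> hecke_atoms_set n x" "u = inv (inv u)"
    by (auto simp: hecke_atoms_set_def demazure_eq_dem dsq_def inv_perms inv_inv_perms)
  then show "u \<in> inv ` hecke_atoms_set n x" by blast
qed

text \<open>At a descent \<open>i\<close>, the involution \<open>x\<close> is the Demazure conjugate
  by \<open>sgen i\<close> of an involution \<open>y\<close> with fewer inversions. If
  \<open>v\<close> has square \<open>y\<close>, then \<open>dem n (sgen i) v\<close> has square
  \<open>x\<close>.\<close>

lemma dsq_surj:
  assumes "x \<in> involutions n"
  obtains u where "u \<in> perms n" "dsq n u = x"
proof -
  have "\<exists>u\<in>perms n. dsq n u = x"
    using assms
  proof (induction "card (inversions n x)" arbitrary: x rule: less_induct)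
    case less
    have x: "x \<in> perms n" using less.prems by (simp add: involutions_def)
    note ix = inv_involution[OF less.prems]
    have xx: "x (x k) = k" for k
      using less.prems by (simp add: involutions_def fun_eq_iff)
    show ?case
    proof (cases "x = id")
      case True
      have "dsq n id = id" using dem_id(1)[OF id_perms] by (metis dsq_def inv_id)
      then show ?thesis using True id_perms by blast
    next
      case False
      obtain i where i: "1 \<le> i" "i < n" "x (Suc i) < x i"
        using perms_exists_descent[OF x False] .
      note s = sgen_perms[OF i(1,2)]
      have *: "\<exists>y\<in>involutions n. card (inversions n y) < card (inversions n x) \<and> x = lop i (rop i y)"
      proof (cases "x i = Suc i \<and> x (Suc i) = i")
        \<comment> \<open>Here \<open>x\<close> commutes with \<open>sgen i\<close>, so ordinary
          conjugation gives nothing shorter. Instead the 2-cycle on \<open>i\<close>,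
          \<open>Suc i\<close> is removed; the right operator restores it and the left one is
          idle.\<close>
        case True
        let ?y = "x \<circ> sgen i"
        have y: "?y \<in> perms n" using comp_perms x s by blast
        have "?y \<circ> ?y = id"
          using True xx perms_inj[OF x] by (auto simp: fun_eq_iff transpose_def) metis+
        then have "?y \<in> involutions n" using y by (simp add: involutions_def)
        moreover have "card (inversions n ?y) < card (inversions n x)"
          using card_inversions_descent[of i n x] i by simp
        moreover have "rop i ?y = x" using True by (simp add: rop_def comp_sgen_sgen)
        moreover have "lop i x = x" using True ix by (simp add: lop_def)
        ultimately show ?thesis by metis
      next
        \<comment> \<open>Ordinary conjugation by \<open>sgen i\<close> now loses an inversion on
          each side.\<close>
        case False
        have ne: "{x (Suc i), x i} \<noteq> {i, Suc i}"
          using False i by (auto simp: doubleton_eq_iff)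
        let ?z = "sgen i \<circ> x"
        let ?y = "?z \<circ> sgen i"
        have z: "?z \<in> perms n" and y: "?y \<in> perms n" using comp_perms x s by blast+
        have iz: "inv ?z = x \<circ> sgen i" using inv_sgen_comp[OF bij_perms[OF x]] ix by simp
        have "?y \<circ> ?y = id" by (simp add: fun_eq_iff xx)
        then have "?y \<in> involutions n" using y by (simp add: involutions_def)
        moreover have "card (inversions n ?z) < card (inversions n x)"
          using card_inversions_descent[of i n x] i card_inversions_inv[OF z] iz by simp
        moreover have lt: "?z (Suc i) < ?z i" using sgen_less_iff[OF ne] i by simp
        moreover have "card (inversions n ?y) < card (inversions n ?z)"
          using card_inversions_descent[of i n ?z] i lt by simp
        moreover have "rop i ?y = ?z" using lt by (simp add: rop_def comp_sgen_sgen)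
        moreover have "lop i ?z = x" using iz i by (simp add: lop_def sgen_sgen_comp)
        ultimately show ?thesis by (metis less_trans)
      qed
      then obtain y where y: "y \<in> involutions n" "card (inversions n y) < card (inversions n x)"
        "x = lop i (rop i y)" by blast
      then obtain v where v: "v \<in> perms n" "dsq n v = y" using less by blast
      have yp: "y \<in> perms n" using y by (simp add: involutions_def)
      have "dsq n (dem n (sgen i) v) = dem n (sgen i) (dem n y (sgen i))"
        using dsq_dem[OF s v(1)] v(2) by simp
      also have "\<dots> = x"
        using dem_sgen_left dem_sgen_right rop_perms i yp y(3) by simp
      finally show ?thesis using dem_perms[OF s v(1)] by blast
    qed
  qed
  then show ?thesis using that by blast
qed

section \<open>Invariance under the Chinese relation\<close>

text \<open>Every multiplication here lengthens, so both sides are ordinary products and the usual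
  braid relation applies.\<close>

lemma dem_braid:
  assumes "1 \<le> i" "Suc i < n"
  shows "dem n (sgen i) (dem n (sgen (Suc i)) (sgen i))
    = dem n (sgen (Suc i)) (dem n (sgen i) (sgen (Suc i)))"
proof -
  have s: "sgen i \<in> perms n" "sgen (Suc i) \<in> perms n" using sgen_perms assms by auto
  have "lop i (lop (Suc i) (sgen i)) = lop (Suc i) (lop i (sgen (Suc i)))"
    by (auto simp: lop_def o_inv_distrib fun_eq_iff transpose_def)
  then show ?thesis using assms s by (simp add: dem_sgen_left lop_perms)
qed

lemma dem_sgen_sgen: "1 \<le> i \<Longrightarrow> i < n \<Longrightarrow> dem n (sgen i) (sgen i) = sgen i"
  using dem_sgen_left[of i n "sgen i"] sgen_perms[of i n] by (simp add: lop_def)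

text \<open>Let w be the braid product. Idempotence of \<open>t\<close> collapses the square of
  \<open>dem n s t\<close> to w. Since w absorbs \<open>s\<close> and \<open>t\<close> on the left,
  the square of w is again w. Conjugation by \<open>p\<close> preserves the equality.\<close>

lemma dsq_braid:
  assumes p: "p \<in> perms n" and st: "s \<in> perms n" "t \<in> perms n" "inv s = s" "inv t = t"
    and ss: "dem n s s = s" "dem n t t = t"
    and braid: "dem n s (dem n t s) = dem n t (dem n s t)"
  shows "dsq n (dem n p (dem n s t)) = dsq n (dem n p (dem n s (dem n t s)))"
proof -
  let ?w = "dem n s (dem n t s)"
  have ssx: "dem n s (dem n s x) = dem n s x" "dem n t (dem n t x) = dem n t x"
    if "x \<in> perms n" for x
    using ss st that dem_assoc by metis+
  have w: "dsq n (dem n s t) = ?w"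
    using st ssx by (simp add: dsq_def inv_dem dem_assoc dem_perms)
  have b: "dem n s ?w = ?w" "dem n t ?w = ?w"
    using ssx braid st dem_perms by metis+
  have "dsq n ?w = dem n ?w ?w"
    using st by (simp add: dsq_def inv_dem dem_assoc dem_perms)
  also have "\<dots> = ?w" using b st by (simp add: dem_assoc dem_perms)
  finally show ?thesis
    using w p st dsq_dem dem_perms by metis
qed

text \<open>Positions \<open>i\<close> to \<open>Suc (Suc i)\<close> of \<open>u\<close> read cab.
  Sorting them to abc gives \<open>p\<close>; lengthening steps from \<open>p\<close> then produce
  \<open>u\<close> as p t s and \<open>u \<circ> ?t\<close> as p t s t, the two sides of
  \<open>dsq_braid\<close>.\<close>

lemma dsq_swap_high:
  assumes u: "u \<in> perms n" and i: "1 \<le> i" "Suc i < n"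
    and lt: "u (Suc i) < u (Suc (Suc i))" "u (Suc (Suc i)) < u i"
  shows "dsq n (u \<circ> sgen (Suc i)) = dsq n u"
proof -
  let ?s = "sgen i" and ?t = "sgen (Suc i)"
  have st: "?s \<in> perms n" "?t \<in> perms n" using sgen_perms i by auto
  define p where "p = u \<circ> ?s \<circ> ?t"
  have p: "p \<in> perms n" unfolding p_def using u st comp_perms by blast
  have "rop (Suc i) p = u \<circ> ?s"
    using lt by (simp add: rop_def p_def comp_sgen_sgen del: comp_apply) (simp add: transpose_def)
  moreover have "rop i (u \<circ> ?s) = u"
    using lt by (simp add: rop_def comp_sgen_sgen)
  moreover have "rop (Suc i) u = u \<circ> ?t" using lt by (simp add: rop_def)
  moreover have "u \<circ> ?s \<in> perms n" using u st comp_perms by blast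
  ultimately have up: "u = dem n (dem n p ?t) ?s" and v: "u \<circ> ?t = dem n u ?t"
    using i p u by (simp_all add: dem_sgen_right)
  have u': "u = dem n p (dem n ?t ?s)" using up p st by (simp add: dem_assoc)
  then have "u \<circ> ?t = dem n p (dem n ?t (dem n ?s ?t))"
    using v p st by (simp add: dem_assoc dem_perms)
  then show ?thesis
    using u' dsq_braid[of p n ?t ?s] p st dem_sgen_sgen dem_braid i by simp
qed

lemma dsq_swap_low:
  assumes u: "u \<in> perms n" and i: "1 \<le> i" "Suc i < n"
    and lt: "u (Suc (Suc i)) < u i" "u i < u (Suc i)"
  shows "dsq n (u \<circ> sgen i) = dsq n u"
proof -
  let ?s = "sgen i" and ?t = "sgen (Suc i)"
  have st: "?s \<in> perms n" "?t \<in> perms n" using sgen_perms i by auto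
  \<comment> \<open>Now \<open>u\<close> reads bca; the sorted \<open>p\<close> reaches it by
    \<open>?s\<close> followed by \<open>?t\<close>.\<close>
  define p where "p = u \<circ> ?t \<circ> ?s"
  have p: "p \<in> perms n" unfolding p_def using u st comp_perms by blast
  have "rop i p = u \<circ> ?t"
    using lt by (simp add: rop_def p_def comp_sgen_sgen del: comp_apply) (simp add: transpose_def)
  moreover have "rop (Suc i) (u \<circ> ?t) = u"
    using lt by (simp add: rop_def comp_sgen_sgen)
  moreover have "rop i u = u \<circ> ?s" using lt by (simp add: rop_def)
  moreover have "u \<circ> ?t \<in> perms n" using u st comp_perms by blast
  ultimately have up: "u = dem n (dem n p ?s) ?t" and v: "u \<circ> ?s = dem n u ?s"
    using i p u by (simp_all add: dem_sgen_right)
  have u': "u = dem n p (dem n ?s ?t)" using up p st by (simp add: dem_assoc)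
  then have "u \<circ> ?s = dem n p (dem n ?s (dem n ?t ?s))"
    using v p st by (simp add: dem_assoc dem_perms)
  then show ?thesis
    using u' dsq_braid[of p n ?s ?t] p st dem_sgen_sgen dem_braid i by simp
qed

section \<open>One-line words and Chinese moves\<close>

lemma length_one_line: "length (one_line n w) = n"
  by (simp add: one_line_def)

lemma nth_one_line: "k < n \<Longrightarrow> one_line n w ! k = int (w (Suc k))"
  by (simp add: one_line_def del: upt_Suc)

lemma distinct_one_line: "w \<in> perms n \<Longrightarrow> distinct (one_line n w)"
  by (simp add: distinct_conv_nth length_one_line nth_one_line perms_inj)

lemma set_one_line: "w \<in> perms n \<Longrightarrow> set (one_line n w) = int ` {1..n}"
  using permutes_image[of w "{1..n}"]
  by (simp add: one_line_def perms_def atLeastLessThanSuc_atLeastAtMost image_image[symmetric]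
      del: upt_Suc)

text \<open>List indices start at 0 but positions of a permutation at 1, hence the generator with
  index \<open>Suc (length xs)\<close>.\<close>

lemma one_line_swap:
  assumes "one_line n w = xs @ [p, q] @ ys"
  shows "one_line n (w \<circ> sgen (Suc (length xs))) = xs @ [q, p] @ ys"
proof (rule nth_equalityI)
  have n: "n = length xs + 2 + length ys"
    using assms length_one_line[of n w] by simp
  then show "length (one_line n (w \<circ> sgen (Suc (length xs)))) = length (xs @ [q, p] @ ys)"
    by (simp add: length_one_line)
  fix k assume "k < length (one_line n (w \<circ> sgen (Suc (length xs))))"
  then have k: "k < n" by (simp add: length_one_line)
  have w: "int (w (Suc j)) = (xs @ [p, q] @ ys) ! j" if "j < n" for j
    using nth_one_line[OF that, of w] assms by simp
  consider "k < length xs" | "k = length xs" | "k = Suc (length xs)" | "k > Suc (length xs)"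
    by linarith
  then show "one_line n (w \<circ> sgen (Suc (length xs))) ! k = (xs @ [q, p] @ ys) ! k"
  proof cases
    case 1
    then show ?thesis using k w[of k] by (simp add: nth_one_line transpose_def nth_append)
  next
    case 2
    then show ?thesis using k w[of "Suc k"] n by (simp add: nth_one_line transpose_def nth_append)
  next
    case 3
    then show ?thesis using k w[of "length xs"] n
      by (simp add: nth_one_line transpose_def nth_append)
  next
    case 4
    then show ?thesis using k w[of k] n
      by (simp add: nth_one_line transpose_def nth_append nth_Cons split: nat.splits)
  qed
qed

lemma perms_eq_if_one_line_eq:
  assumes "u \<in> perms n" "v \<in> perms n" "one_line n u = one_line n v"
  shows "u = v"
proof
  fix k
  show "u k = v k"
  proof (cases "k \<in> {1..n}")
    case True
    then have "int (u (Suc (k - 1))) = int (v (Suc (k - 1)))"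
      using assms(3) nth_one_line[of "k - 1" n] by (metis One_nat_def Suc_pred atLeastAtMost_iff less_eq_Suc_le)
    then show ?thesis using True by simp
  next
    case False
    then show ?thesis using assms by (simp add: perms_def permutes_not_in)
  qed
qed

lemma one_line_triple:
  assumes w: "w \<in> perms n" and e: "one_line n w = xs @ [p, q, r] @ ys" and i: "i = Suc (length xs)"
  shows "1 \<le> i" "Suc i < n" "int (w i) = p" "int (w (Suc i)) = q" "int (w (Suc (Suc i))) = r"
    "p \<noteq> q" "q \<noteq> r" "p \<noteq> r"
proof -
  have n: "n = length xs + 3 + length ys" using e length_one_line[of n w] by simp
  then show "1 \<le> i" "Suc i < n" using i by auto
  show "int (w i) = p" "int (w (Suc i)) = q" "int (w (Suc (Suc i))) = r"
    using nth_one_line[of "length xs" n w] nth_one_line[of "Suc (length xs)" n w]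
      nth_one_line[of "Suc (Suc (length xs))" n w] n e i
    by (simp_all add: nth_append)
  show "p \<noteq> q" "q \<noteq> r" "p \<noteq> r" using distinct_one_line[OF w] e by auto
qed

text \<open>The arrangement cba is one neighbouring swap away from both cab and bca, so every
  Chinese move is routed through it. Distinctness of the letters makes the inequalities strict, as
  \<open>dsq_swap_high\<close> demands.\<close>

lemma one_line_cab_cba:
  assumes w: "w \<in> perms n" and e: "one_line n w = xs @ [c, a, b] @ ys" and le: "a \<le> b" "b \<le> c"
  obtains v where "v \<in> perms n" "one_line n v = xs @ [c, b, a] @ ys" "dsq n v = dsq n w"
proof -
  define i where "i = Suc (length xs)"
  note t = one_line_triple[OF w e i_def]
  have "w \<circ> sgen (Suc i) \<in> perms n" using t w by (intro comp_perms sgen_perms) auto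
  moreover have "one_line n (w \<circ> sgen (Suc i)) = xs @ [c, b, a] @ ys"
    using one_line_swap[of n w "xs @ [c]" a b ys] e by (simp add: i_def)
  moreover have "dsq n (w \<circ> sgen (Suc i)) = dsq n w"
    by (rule dsq_swap_high) (use t w le in auto)
  ultimately show ?thesis using that by blast
qed

lemma one_line_bca_cba:
  assumes w: "w \<in> perms n" and e: "one_line n w = xs @ [b, c, a] @ ys" and le: "a \<le> b" "b \<le> c"
  obtains v where "v \<in> perms n" "one_line n v = xs @ [c, b, a] @ ys" "dsq n v = dsq n w"
proof -
  define i where "i = Suc (length xs)"
  note t = one_line_triple[OF w e i_def]
  have "w \<circ> sgen i \<in> perms n" using t w by (intro comp_perms sgen_perms) auto
  moreover have "one_line n (w \<circ> sgen i) = xs @ [c, b, a] @ ys"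
    using one_line_swap[of n w xs b c "a # ys"] e by (simp add: i_def)
  moreover have "dsq n (w \<circ> sgen i) = dsq n w"
    by (rule dsq_swap_low) (use t w le in auto)
  ultimately show ?thesis using that by blast
qed

text \<open>The swap is made first; the forward lemma applied to its result leads back to the word
  of \<open>w\<close>, and a permutation is determined by its word.\<close>

lemma one_line_cba_cab:
  assumes w: "w \<in> perms n" and e: "one_line n w = xs @ [c, b, a] @ ys" and le: "a \<le> b" "b \<le> c"
  obtains v where "v \<in> perms n" "one_line n v = xs @ [c, a, b] @ ys" "dsq n v = dsq n w"
proof -
  define v where "v = w \<circ> sgen (Suc (Suc (length xs)))"
  have v: "v \<in> perms n" unfolding v_def
    using one_line_triple[OF w e refl] w by (intro comp_perms sgen_perms) auto
  have e': "one_line n v = xs @ [c, a, b] @ ys"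
    using one_line_swap[of n w "xs @ [c]" b a ys] e by (simp add: v_def)
  obtain w' where "w' \<in> perms n" "one_line n w' = xs @ [c, b, a] @ ys" "dsq n w' = dsq n v"
    using one_line_cab_cba[OF v e' le] .
  then show ?thesis using that[OF v e'] perms_eq_if_one_line_eq[of w' n w] w e by simp
qed

lemma one_line_cba_bca:
  assumes w: "w \<in> perms n" and e: "one_line n w = xs @ [c, b, a] @ ys" and le: "a \<le> b" "b \<le> c"
  obtains v where "v \<in> perms n" "one_line n v = xs @ [b, c, a] @ ys" "dsq n v = dsq n w"
proof -
  define v where "v = w \<circ> sgen (Suc (length xs))"
  have v: "v \<in> perms n" unfolding v_def
    using one_line_triple[OF w e refl] w by (intro comp_perms sgen_perms) auto
  have e': "one_line n v = xs @ [b, c, a] @ ys"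
    using one_line_swap[of n w xs c b "a # ys"] e by (simp add: v_def)
  obtain w' where "w' \<in> perms n" "one_line n w' = xs @ [c, b, a] @ ys" "dsq n w' = dsq n v"
    using one_line_bca_cba[OF v e' le] .
  then show ?thesis using that[OF v e'] perms_eq_if_one_line_eq[of w' n w] w e by simp
qed

text \<open>A chain of moves runs through arbitrary lists; producing \<open>v\<close> shows that
  each remains the word of a permutation. Both directions serve the symmetric closure.\<close>

lemma chinese_step_dsq:
  assumes "w \<in> perms n"
  shows "chinese_step (one_line n w) ys \<Longrightarrow> \<exists>v\<in>perms n. one_line n v = ys \<and> dsq n v = dsq n w"
    and "chinese_step ys (one_line n w) \<Longrightarrow> \<exists>v\<in>perms n. one_line n v = ys \<and> dsq n v = dsq n w"
proof -
  assume "chinese_step (one_line n w) ys"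
  then show "\<exists>v\<in>perms n. one_line n v = ys \<and> dsq n v = dsq n w"
  proof cases
    case (cab_bca a b c us vs)
    obtain v where "v \<in> perms n" "one_line n v = us @ [c, b, a] @ vs" "dsq n v = dsq n w"
      using one_line_cab_cba[OF assms cab_bca(1,3,4)] .
    then show ?thesis using one_line_cba_bca[of v n us c b a vs] cab_bca by metis
  next
    case (bca_cba a b c us vs)
    then show ?thesis using one_line_bca_cba[OF assms bca_cba(1,3,4)] by metis
  qed
next
  assume "chinese_step ys (one_line n w)"
  then show "\<exists>v\<in>perms n. one_line n v = ys \<and> dsq n v = dsq n w"
  proof cases
    case (cab_bca a b c us vs)
    obtain v where "v \<in> perms n" "one_line n v = us @ [c, b, a] @ vs" "dsq n v = dsq n w"
      using one_line_bca_cba[OF assms cab_bca(2,3,4)] .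
    then show ?thesis using one_line_cba_cab[of v n us c b a vs] cab_bca by metis
  next
    case (bca_cba a b c us vs)
    then show ?thesis using one_line_cba_bca[OF assms bca_cba(2,3,4)] by metis
  qed
qed

lemma chinese_equiv_dsq:
  assumes "u \<in> perms n" "v \<in> perms n" "chinese_equiv (one_line n u) (one_line n v)"
  shows "dsq n u = dsq n v"
proof -
  have "\<exists>w\<in>perms n. one_line n w = ys \<and> dsq n w = dsq n u"
    if "equivclp chinese_step (one_line n u) ys" for ys
    using that
  proof (induction rule: equivclp_induct)
    case base
    then show ?case using assms(1) by blast
  next
    case (step ys zs)
    then show ?case using chinese_step_dsq by metis
  qed
  then show ?thesis
    using assms perms_eq_if_one_line_eq unfolding chinese_equiv_def by metis
qed

section \<open>Canonical words\<close>

lemma chinese_step_append: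
  "chinese_step us vs \<Longrightarrow> chinese_step (us @ zs) (vs @ zs)"
proof (induction rule: chinese_step.induct)
  case (cab_bca a b c xs ys)
  then show ?case using chinese_step.cab_bca[of a b c xs "ys @ zs"] by simp
next
  case (bca_cba a b c xs ys)
  then show ?case using chinese_step.bca_cba[of a b c xs "ys @ zs"] by simp
qed

text \<open>Compatibility on the right suffices: insertion rewrites a prefix while finished blocks
  stay to its right.\<close>

lemma chinese_equiv_append:
  assumes "chinese_equiv us vs"
  shows "chinese_equiv (us @ zs) (vs @ zs)"
  using assms unfolding chinese_equiv_def
proof (induction rule: equivclp_induct)
  case (step vs ws)
  then show ?case using chinese_step_append equivclp_into_equivclp by metis
qed simp

lemma mset_chinese_equiv:
  assumes "chinese_equiv us vs"
  shows "mset us = mset vs"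
  using assms unfolding chinese_equiv_def
  by (induction rule: equivclp_induct) (auto elim!: chinese_step.cases)

lemma chinese_equiv_sym: "chinese_equiv us vs \<Longrightarrow> chinese_equiv vs us"
  unfolding chinese_equiv_def by (rule equivclp_sym)

lemma chinese_equiv_trans [trans]:
  "chinese_equiv us vs \<Longrightarrow> chinese_equiv vs ws \<Longrightarrow> chinese_equiv us ws"
  unfolding chinese_equiv_def by (rule equivclp_trans)

text \<open>If \<open>a \<le> z\<close>, the triple is a cab and becomes bca; otherwise it is a cba,
  and the second rule is used backwards to reach bca.\<close>

lemma chinese_equiv_bump:
  assumes "a \<le> b" "z \<le> b"
  shows "chinese_equiv (xs @ [b, a, z]) (xs @ [max a z, b, min a z])"
proof (cases "a \<le> z")
  case True
  then show ?thesis
    using chinese_step.cab_bca[of a z b xs "[]"] assms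
    unfolding chinese_equiv_def by (auto simp: max_def)
next
  case False
  then show ?thesis
    using chinese_step.bca_cba[of z a b xs "[]"] assms
    unfolding chinese_equiv_def by (auto simp: max_def)
qed

text \<open>The pair \<open>(b, b)\<close> encodes a singleton, so that pairs match the cycles of an
  involution, fixed points included.\<close>

fun block :: "nat \<times> nat \<Rightarrow> nat list" where
  "block (b, a) = (if a = b then [b] else [b, a])"

definition block_word :: "(nat \<times> nat) list \<Rightarrow> nat list" where
  "block_word bs = concat (map block bs)"

definition canonical :: "(nat \<times> nat) list \<Rightarrow> bool" where
  "canonical bs \<longleftrightarrow> sorted_wrt (<) (map fst bs) \<and> (\<forall>(b, a) \<in> set bs. a \<le> b)"

lemma block_word_simps:
  "block_word [] = []"
  "block_word (p # bs) = block p @ block_word bs"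
  "block_word (bs @ cs) = block_word bs @ block_word cs"
  by (simp_all add: block_word_def)

lemma canonical_snoc:
  "canonical (bs @ [(b, a)]) \<longleftrightarrow> canonical bs \<and> a \<le> b \<and> (\<forall>p\<in>set bs. fst p < b)"
  by (auto simp: canonical_def sorted_wrt_append)

text \<open>A new letter \<open>z\<close> reaching a pair \<open>b a\<close> with \<open>z < b\<close> leaves the smaller of \<open>a\<close>, \<open>z\<close>
  behind \<open>b\<close> and carries the larger one on to the left, until the carried letter completes a
  singleton or meets a block with smaller first letter.\<close>

lemma canonical_insert:
  assumes "canonical bs" "distinct (block_word bs @ [z])"
  shows "\<exists>cs. canonical cs
    \<and> chinese_equiv (map int (block_word bs @ [z])) (map int (block_word cs))
    \<and> (\<forall>m. (\<forall>p\<in>set bs. fst p < m) \<longrightarrow> z < m \<longrightarrow> (\<forall>p\<in>set cs. fst p < m))"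
  using assms
proof (induction bs arbitrary: z rule: rev_induct)
  case Nil
  show ?case
    by (rule exI[of _ "[(z, z)]"]) (simp add: canonical_def block_word_simps chinese_equiv_def)
next
  case (snoc p bs)
  obtain b a where p: "p = (b, a)" by fastforce
  have can: "canonical bs" "a \<le> b" "\<forall>p\<in>set bs. fst p < b"
    using snoc.prems(1) by (simp_all add: p canonical_snoc)
  have ne: "z \<noteq> b" using snoc.prems(2) by (auto simp: p block_word_simps split: if_splits)
  show ?case
  proof (cases "b < z")
    case True
    have "canonical (bs @ [p] @ [(z, z)])"
      using snoc.prems(1) can True
      by (simp only: append_assoc[symmetric] canonical_snoc) (auto simp: p)
    then show ?thesis
      by (intro exI[of _ "bs @ [p] @ [(z, z)]"]) (auto simp: block_word_simps chinese_equiv_def)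
  next
    case False
    then have z: "z < b" using ne by simp
    show ?thesis
    proof (cases "a = b")
      case True
      have "canonical (bs @ [(b, z)])" using can z by (simp add: canonical_snoc)
      then show ?thesis using z True
        by (intro exI[of _ "bs @ [(b, z)]"]) (auto simp: p block_word_simps chinese_equiv_def)
    next
      case False
      then have a: "a < b" using can by simp
      have "distinct (block_word bs @ [max a z])"
        using snoc.prems(2) False by (auto simp: p block_word_simps max_def)
      from snoc.IH[OF can(1) this] obtain cs where cs: "canonical cs"
        "chinese_equiv (map int (block_word bs @ [max a z])) (map int (block_word cs))"
        "\<And>m. (\<forall>p\<in>set bs. fst p < m) \<Longrightarrow> max a z < m \<Longrightarrow> \<forall>p\<in>set cs. fst p < m"
        by blast
      \<comment> \<open>The clause on \<open>m\<close>, taken at \<open>b\<close>, keeps all first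
        letters of \<open>cs\<close> below \<open>b\<close>, so the block can be put back at the
        end.\<close>
      have "canonical (cs @ [(b, min a z)])"
        using cs(1) cs(3)[OF can(3)] a z by (simp add: canonical_snoc)
      moreover have "chinese_equiv (map int (block_word (bs @ [p]) @ [z]))
          (map int (block_word (cs @ [(b, min a z)])))"
      proof -
        have "chinese_equiv (map int (block_word bs) @ [int b, int a, int z])
            (map int (block_word bs @ [max a z]) @ [int b, int (min a z)])"
          using chinese_equiv_bump[of "int a" "int b" "int z"] a z by (simp add: of_nat_max of_nat_min)
        also have "chinese_equiv \<dots> (map int (block_word cs) @ [int b, int (min a z)])"
          using cs(2) by (rule chinese_equiv_append)
        finally show ?thesis using a z by (simp add: p block_word_simps min_def)
      qed
      moreover have "\<forall>m. (\<forall>q\<in>set (bs @ [p]). fst q < m) \<longrightarrow> z < m \<longrightarrow>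
          (\<forall>q\<in>set (cs @ [(b, min a z)]). fst q < m)"
        using cs(3) a by (auto simp: p)
      ultimately show ?thesis by blast
    qed
  qed
qed

lemma canonical_exists:
  assumes "distinct us"
  obtains bs where "canonical bs" "chinese_equiv (map int us) (map int (block_word bs))"
proof -
  have "\<exists>bs. canonical bs \<and> chinese_equiv (map int us) (map int (block_word bs))"
    using assms
  proof (induction us rule: rev_induct)
    case Nil
    show ?case
      by (rule exI[of _ "[]"]) (simp add: canonical_def block_word_simps chinese_equiv_def)
  next
    case (snoc z us)
    then obtain bs where bs: "canonical bs" "chinese_equiv (map int us) (map int (block_word bs))"
      by auto
    have e: "chinese_equiv (map int (us @ [z])) (map int (block_word bs @ [z]))"
      using chinese_equiv_append[OF bs(2)] by simp
    \<comment> \<open>Chinese moves only rearrange letters, so distinctness survives for the next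
      insertion.\<close>
    have "mset (us @ [z]) = mset (block_word bs @ [z])"
      using mset_chinese_equiv[OF e]
      by (metis inj_of_nat mset_map multiset.inj_map injD)
    then have "distinct (block_word bs @ [z])"
      using snoc.prems mset_eq_imp_distinct_iff by blast
    then obtain cs where "canonical cs"
      "chinese_equiv (map int (block_word bs @ [z])) (map int (block_word cs))"
      using canonical_insert[OF bs(1)] by blast
    then show ?case using chinese_equiv_trans[OF e] by blast
  qed
  then show ?thesis using that by blast
qed

section \<open>Canonical words and involutions\<close>

fun block_involution :: "(nat \<times> nat) list \<Rightarrow> nat \<Rightarrow> nat" where
  "block_involution [] = id"
| "block_involution ((b, a) # bs) = transpose b a \<circ> block_involution bs"

lemma block_involution_outside:
  "k \<notin> set (block_word bs) \<Longrightarrow> block_involution bs k = k"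
  by (induction bs rule: block_involution.induct)
    (auto simp: block_word_simps transpose_def split: if_splits)

lemma block_involution_inside:
  assumes "distinct (block_word bs)" "(b, a) \<in> set bs"
  shows "block_involution bs b = a \<and> block_involution bs a = b"
  using assms
proof (induction bs rule: block_involution.induct)
  case (2 d c bs)
  have d: "distinct (block_word bs)" "d \<notin> set (block_word bs)" "c \<notin> set (block_word bs)"
    using 2(2) by (auto simp: block_word_simps split: if_splits)
  show ?case
  proof (cases "(b, a) = (d, c)")
    case True
    then show ?thesis using d block_involution_outside by simp
  next
    case False
    then have ba: "(b, a) \<in> set bs" using 2(3) by auto
    then have "b \<in> set (block_word bs)" "a \<in> set (block_word bs)"
      by (force simp: block_word_def)+
    then have "b \<noteq> d" "b \<noteq> c" "a \<noteq> d" "a \<noteq> c" using d by auto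
    then show ?thesis using 2(1)[OF d(1) ba] by simp
  qed
qed simp

text \<open>For an involution, \<open>x i \<le> i\<close> picks the larger element of each cycle, so
  the cycles are listed by increasing maxima.\<close>

definition involution_word :: "nat \<Rightarrow> (nat \<Rightarrow> nat) \<Rightarrow> nat list" where
  "involution_word n x =
     block_word (map (\<lambda>i. (i, x i)) (sorted_list_of_set {i \<in> {1..n}. x i \<le> i}))"

text \<open>Distinct letters make the blocks disjoint cycles of \<open>block_involution bs\<close>.
  Their first letters are the cycle maxima, and the increasing order leaves only one way to list
  them.\<close>

lemma canonical_involution_word:
  assumes can: "canonical bs" and dist: "distinct (block_word bs)"
    and set: "set (block_word bs) = {1..n}"
  obtains x where "x \<in> involutions n" "block_word bs = involution_word n x"
proof -
  let ?x = "block_involution bs"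
  note inside = block_involution_inside[OF dist]
  have mem: "\<exists>a b. (b, a) \<in> set bs \<and> (k = a \<or> k = b)" if "k \<in> {1..n}" for k
    using that unfolding set[symmetric] by (auto simp: block_word_def split: if_splits) blast+
  have mem': "b \<in> {1..n}" "a \<in> {1..n}" if "(b, a) \<in> set bs" for a b
    using that unfolding set[symmetric] by (force simp: block_word_def)+
  have out: "?x k = k" if "k \<notin> {1..n}" for k
    using that block_involution_outside set by blast
  have xx: "?x (?x k) = k" for k
    using mem[of k] inside out[of k] by (cases "k \<in> {1..n}") metis+
  then have "?x permutes {1..n}" using out by (metis permutes_def)
  then have inv: "?x \<in> involutions n"
    using xx by (simp add: involutions_def perms_def fun_eq_iff)
  have "set (map fst bs) = {i \<in> {1..n}. ?x i \<le> i}"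
  proof (intro equalityI subsetI)
    fix i assume "i \<in> set (map fst bs)"
    then obtain a where a: "(i, a) \<in> set bs" by auto
    moreover have "a \<le> i" using can a by (auto simp: canonical_def)
    ultimately show "i \<in> {i \<in> {1..n}. ?x i \<le> i}" using inside mem' by auto
  next
    fix i assume i: "i \<in> {i \<in> {1..n}. ?x i \<le> i}"
    then obtain a b where ab: "(b, a) \<in> set bs" "i = a \<or> i = b" using mem by blast
    then have "a \<le> b" "?x b = a" "?x a = b" using can inside by (auto simp: canonical_def)
    then have "i = b" using ab i by auto
    then show "i \<in> set (map fst bs)" using ab by force
  qed
  then have "map fst bs = sorted_list_of_set {i \<in> {1..n}. ?x i \<le> i}"
    using can by (metis canonical_def sorted_list_of_set.idem_if_sorted_distinct
        strict_sorted_iff)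
  moreover have "map (\<lambda>i. (i, ?x i)) (map fst bs) = bs"
    using inside by (auto intro!: map_idI)
  ultimately have "block_word bs = involution_word n ?x" by (simp add: involution_word_def)
  then show ?thesis using that inv by blast
qed

lemma chinese_equiv_involution_word:
  assumes "u \<in> perms n"
  obtains x where "x \<in> involutions n"
    "chinese_equiv (one_line n u) (map int (involution_word n x))"
proof -
  define us where "us = map u [1..<Suc n]"
  have us: "one_line n u = map int us" by (simp add: us_def one_line_def del: upt_Suc)
  have "distinct us" using distinct_one_line[OF assms] by (simp add: us distinct_map)
  then obtain bs where bs: "canonical bs" "chinese_equiv (map int us) (map int (block_word bs))"
    using canonical_exists by blast
  have m: "mset us = mset (block_word bs)"
    using mset_chinese_equiv[OF bs(2)] by (metis inj_of_nat mset_map multiset.inj_map injD)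
  have "int ` set us = int ` {1..n}" using set_one_line[OF assms] by (simp add: us)
  then have "set us = {1..n}" by (metis inj_image_eq_iff inj_of_nat)
  then have "set (block_word bs) = {1..n}" using m by (metis mset_eq_setD)
  moreover have "distinct (block_word bs)"
    using m \<open>distinct us\<close> mset_eq_imp_distinct_iff by blast
  ultimately show ?thesis
    using canonical_involution_word[OF bs(1)] that bs(2) us by metis
qed

text \<open>Choosing a permutation with each given Demazure square and passing to its canonical word gives
  an injective self-map of the finite set of involutions; by surjectivity no further canonical
  words are left.\<close>

lemma dsq_eq_imp_chinese_equiv:
  assumes u: "u \<in> perms n" and v: "v \<in> perms n" and eq: "dsq n u = dsq n v"
  shows "chinese_equiv (one_line n u) (one_line n v)"
proof -
  let ?I = "involutions n"
  have "\<forall>y\<in>?I. \<exists>w. w \<in> perms n \<and> dsq n w = y"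
    using dsq_surj by blast
  then obtain f where "\<forall>y\<in>?I. f y \<in> perms n \<and> dsq n (f y) = y"
    by (rule bchoice[THEN exE])
  then have f: "f y \<in> perms n" "dsq n (f y) = y" if "y \<in> ?I" for y
    using that by simp_all
  have "\<forall>y\<in>?I. \<exists>x. x \<in> ?I
      \<and> chinese_equiv (one_line n (f y)) (map int (involution_word n x))"
    using chinese_equiv_involution_word f(1) by blast
  then obtain g where "\<forall>y\<in>?I. g y \<in> ?I
      \<and> chinese_equiv (one_line n (f y)) (map int (involution_word n (g y)))"
    by (rule bchoice[THEN exE])
  then have g: "g y \<in> ?I"
    "chinese_equiv (one_line n (f y)) (map int (involution_word n (g y)))" if "y \<in> ?I" for y
    using that by simp_all
  \<comment> \<open>A shared canonical word makes the chosen permutations equivalent, and invariance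
    then equates their squares.\<close>
  have "inj_on g ?I"
  proof (rule inj_onI)
    fix y z assume yz: "y \<in> ?I" "z \<in> ?I" "g y = g z"
    have "chinese_equiv (one_line n (f y)) (one_line n (f z))"
      using chinese_equiv_trans[OF g(2)[OF yz(1)]] chinese_equiv_sym[OF g(2)[OF yz(2)]] yz(3)
      by simp
    then have "dsq n (f y) = dsq n (f z)"
      using chinese_equiv_dsq[OF f(1)[OF yz(1)] f(1)[OF yz(2)]] by blast
    then show "y = z" using f(2) yz by simp
  qed
  moreover have "finite ?I"
    by (rule finite_subset[of _ "perms n"])
      (auto simp: involutions_def perms_def finite_permutations)
  moreover have "g ` ?I \<subseteq> ?I" using g by blast
  ultimately have surj: "g ` ?I = ?I" by (simp add: endo_inj_surj)
  have *: "chinese_equiv (one_line n w) (one_line n (f (dsq n w)))" if w: "w \<in> perms n" for w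
  proof -
    obtain x where x: "x \<in> ?I" "chinese_equiv (one_line n w) (map int (involution_word n x))"
      using chinese_equiv_involution_word[OF w] .
    \<comment> \<open>By surjectivity the canonical word of \<open>w\<close> is also that of some
      \<open>f y\<close>; invariance identifies \<open>y\<close> as \<open>dsq n w\<close>.\<close>
    obtain y where y: "y \<in> ?I" "x = g y" using surj x(1) by blast
    have "chinese_equiv (one_line n w) (one_line n (f y))"
      using chinese_equiv_trans[OF x(2)] chinese_equiv_sym[OF g(2)[OF y(1)]] y(2) by simp
    moreover from this have "dsq n w = y"
      using chinese_equiv_dsq[OF w f(1)[OF y(1)]] f(2)[OF y(1)] by simp
    ultimately show ?thesis by simp
  qed
  show ?thesis using chinese_equiv_trans[OF *[OF u]] chinese_equiv_sym[OF *[OF v]] eq by simp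
qed

theorem theorem6p5:
  fixes n :: nat
  shows "(\<lambda>x. inv ` hecke_atoms_set n x) ` involutions n = perms n // chinese_rel n
    \<and> inj_on (\<lambda>x. inv ` hecke_atoms_set n x) (involutions n)"
proof
  \<comment> \<open>Invariance and separation together identify the Chinese classes with the fibres
    of \<open>dsq n\<close>.\<close>
  have cls: "chinese_rel n `` {u} = {v \<in> perms n. dsq n v = dsq n u}" if "u \<in> perms n" for u
  proof -
    have "chinese_equiv (one_line n u) (one_line n v) \<longleftrightarrow> dsq n v = dsq n u" if "v \<in> perms n" for v
      using \<open>u \<in> perms n\<close> that chinese_equiv_dsq[of u n v] dsq_eq_imp_chinese_equiv[of u n v] by argo
    then show ?thesis using that by (auto simp: chinese_rel_def)
  qed
  show "(\<lambda>x. inv ` hecke_atoms_set n x) ` involutions n = perms n // chinese_rel n"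
  proof (intro equalityI subsetI)
    fix A assume "A \<in> (\<lambda>x. inv ` hecke_atoms_set n x) ` involutions n"
    then obtain x where x: "x \<in> involutions n" "A = {u \<in> perms n. dsq n u = x}"
      by (auto simp: inv_image_hecke_atoms)
    obtain u where u: "u \<in> perms n" "dsq n u = x" using dsq_surj[OF x(1)] .
    then have "A = chinese_rel n `` {u}" using cls x by simp
    then show "A \<in> perms n // chinese_rel n" using u by (simp add: quotientI)
  next
    fix A assume "A \<in> perms n // chinese_rel n"
    then obtain u where u: "u \<in> perms n" "A = chinese_rel n `` {u}" by (rule quotientE)
    then have "A = inv ` hecke_atoms_set n (dsq n u)" using cls by (simp add: inv_image_hecke_atoms)
    then show "A \<in> (\<lambda>x. inv ` hecke_atoms_set n x) ` involutions n"
      using dsq_involution[OF u(1)] by blast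
  qed
  show "inj_on (\<lambda>x. inv ` hecke_atoms_set n x) (involutions n)"
  proof (rule inj_onI)
    fix x y assume xy: "x \<in> involutions n" "y \<in> involutions n"
      "inv ` hecke_atoms_set n x = inv ` hecke_atoms_set n y"
    obtain u where "u \<in> perms n" "dsq n u = x" using dsq_surj[OF xy(1)] .
    \<comment> \<open>The fibre over \<open>x\<close> is non-empty, and its member \<open>u\<close>
      also lies over \<open>y\<close>.\<close>
    then show "x = y" using xy(3) by (auto simp: inv_image_hecke_atoms)
  qed
qed

end
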